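(* Let $K\ge2$ and consider $K$-class classification with symmetric label noise of rate $\epsilon$, where $0\le\epsilon<\frac{K-1}{K}$. Let $r^*\le1$, let $f^*_{\mathcal D}\in\arg\min_{f\in\mathcal F}\mathbb{E}_{(X,Y)\sim\mathcal D}[\ell(\mathbf f(X),Y^{\mathrm{GLS},r^*})]$, and define $$r_{\mathrm{opt}}:=\frac{(K-1)\,r^*-K\epsilon}{(K-1)-K\epsilon}.$$ Then learning on the noisy data with smooth rate $r=r_{\mathrm{opt}}$ yields $f^*_{\mathcal D}$, i.e. $f^*_{\mathcal D}$ is a minimizer over $\mathcal F$ of $\mathbb{E}_{(X,\widetilde Y)\sim\widetilde{\mathcal D}}[\ell(\mathbf f(X),\widetilde Y^{\mathrm{GLS},r_{\mathrm{opt}}})]$. Moreover: - if $\epsilon<\frac{(K-1)r^*}{K}$, then $r_{\mathrm{opt}}>0$ (label smoothing); - if $\epsilon=\frac{(K-1)r^*}{K}$, then $r_{\mathrm{opt}}=0$ (vanilla loss); - if $\epsilon>\frac{(K-1)r^*}{K}$, then $r_{\mathrm{opt}}<0$ (negative label smoothing).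
   Context: $(X,Y)\sim\mathcal D$ with $X\in\mathcal X$ and clean label $Y\in[K]=\{1,\dots,K\}$. The noisy label $\widetilde Y\in[K]$ is conditionally independent of $X$ given $Y$, and the noise is symmetric: $\mathbb P(\widetilde Y=i\mid Y=i)=1-\epsilon$ and $\mathbb P(\widetilde Y=j\mid Y=i)=\frac{\epsilon}{K-1}$ for $j\ne i$. $\widetilde{\mathcal D}$ is the law of $(X,\widetilde Y)$. A classifier $f$ assigns to each $x$ a probability vector $\mathbf f(x)=(\mathbf f(x)_k)_{k\in[K]}$ with strictly positive entries summing to 1 (a softmax output). $\mathcal F$ is a class of measurable classifiers such that $\log \mathbf f(X)_k$ is integrable for every $f\in\mathcal F$ and $k\in[K]$. The loss is cross-entropy, $\ell(\mathbf f(x),y)=-\log \mathbf f(x)_y$, extended linearly to vector labels: $\ell(\mathbf f(x),\mathbf v)=-\sum_{k\in[K]} v_k\log\mathbf f(x)_k$ for $\mathbf v\in\mathbb R^K$. Generalized label smoothing: for a label $y$ with one-hot vector $\mathbf y\in\mathbb R^K$ and $r\le1$, the smoothed label is $\mathbf y^{\mathrm{GLS},r}=(1-r)\mathbf y+\frac rK\mathbf 1$, where $\mathbf 1$ is the all-ones vector. $Y^{\mathrm{GLS},r}$ and $\widetilde Y^{\mathrm{GLS},r}$ denote the smoothed versions of $Y$ and $\widetilde Y$. Role of $r^*$ (standing assumption): $r^*\le 1$ is the smooth rate for which learning on the clean distribution $\mathcal D$ with that rate makes the resulting classifier $f^*_{\mathcal D}$ (a minimizer of the clean $r^*$-smoothed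 risk) perform best on unseen clean test data. *)

theory Defs
  imports "HOL-Probability.Probability"
begin

text \<open>
  The label set \<open>[K]\<close> is a finite type \<open>'k\<close> with \<open>K = CARD('k)\<close>; vectors indexed by labels
  have type \<open>real ^ 'k\<close>.
\<close>

definition one_hot :: "'k::finite \<Rightarrow> real ^ 'k" where
  "one_hot y = axis y 1"

text \<open>\<open>vec 1\<close> is the all-ones vector.  The rate \<open>r\<close> may be negative.\<close>

definition gls :: "real \<Rightarrow> 'k::finite \<Rightarrow> real ^ 'k" where
  "gls r y = (1 - r) *\<^sub>R one_hot y + (r / real CARD('k)) *\<^sub>R vec 1"

definition ce_loss :: "real ^ 'k::finite \<Rightarrow> 'k \<Rightarrow> real" where
  "ce_loss p y = - ln (p $ y)"

text \<open>Linear extension of \<^const>\<open>ce_loss\<close> to vector labels.\<close>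

definition ce_loss_vec :: "real ^ 'k::finite \<Rightarrow> real ^ 'k \<Rightarrow> real" where
  "ce_loss_vec p v = - (\<Sum>k\<in>UNIV. v $ k * ln (p $ k))"

lemma ce_loss_vec_one_hot: "ce_loss_vec p (one_hot y) = ce_loss p y"
  by (simp add: ce_loss_vec_def one_hot_def ce_loss_def axis_def if_distrib[of "\<lambda>x. x * _"]
        cong: if_cong)

definition classifier :: "'x measure \<Rightarrow> ('x \<Rightarrow> real ^ 'k::finite) \<Rightarrow> bool" where
  "classifier N f \<longleftrightarrow>
     f \<in> borel_measurable N \<and>
     (\<forall>x\<in>space N. (\<forall>k. 0 < f x $ k) \<and> (\<Sum>k\<in>UNIV. f x $ k) = 1)"

text \<open>The law of a feature-label pair: \<open>\<D>\<close> for the clean label, its noisy counterpart for the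
  noisy label.\<close>

definition data_law ::
  "'w measure \<Rightarrow> 'x measure \<Rightarrow> ('w \<Rightarrow> 'x) \<Rightarrow> ('w \<Rightarrow> 'k) \<Rightarrow> ('x \<times> 'k) measure" where
  "data_law M N X Y = distr M (N \<Otimes>\<^sub>M count_space UNIV) (\<lambda>w. (X w, Y w))"

definition gls_risk ::
  "('x \<times> 'k) measure \<Rightarrow> real \<Rightarrow> ('x \<Rightarrow> real ^ 'k::finite) \<Rightarrow> real" where
  "gls_risk D r f = (LINT (x, y)|D. ce_loss_vec (f x) (gls r y))"

text \<open>
  Conditioning is only required on labels of positive probability, since \<^const>\<open>cond_prob\<close> is
  0 when the conditioning event is null.
\<close>

definition cond_indep_given_label ::
  "'w measure \<Rightarrow> 'x measure \<Rightarrow> ('w \<Rightarrow> 'x) \<Rightarrow> ('w \<Rightarrow> 'k) \<Rightarrow> ('w \<Rightarrow> 'k) \<Rightarrow> bool" where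
  "cond_indep_given_label M N X Yn Y \<longleftrightarrow>
     (\<forall>A\<in>sets N. \<forall>i j. \<P>(w in M. Y w = i) > 0 \<longrightarrow>
        \<P>(w in M. X w \<in> A \<and> Yn w = j \<bar> Y w = i) =
        \<P>(w in M. X w \<in> A \<bar> Y w = i) * \<P>(w in M. Yn w = j \<bar> Y w = i))"

definition symmetric_noise ::
  "'w measure \<Rightarrow> real \<Rightarrow> ('w \<Rightarrow> 'k::finite) \<Rightarrow> ('w \<Rightarrow> 'k) \<Rightarrow> bool" where
  "symmetric_noise M \<epsilon> Yn Y \<longleftrightarrow>
     (\<forall>i j. \<P>(w in M. Y w = i) > 0 \<longrightarrow>
        \<P>(w in M. Yn w = j \<bar> Y w = i) =
        (if j = i then 1 - \<epsilon> else \<epsilon> / (real CARD('k) - 1)))"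

definition r_opt :: "nat \<Rightarrow> real \<Rightarrow> real \<Rightarrow> real" where
  "r_opt K rs \<epsilon> = ((real K - 1) * rs - real K * \<epsilon>) / ((real K - 1) - real K * \<epsilon>)"

end

theory Submission
  imports Defs
begin

text \<open>
  Symmetric noise acts on the one-hot label vector, in conditional expectation, as label smoothing
  with rate \<open>s = K \<epsilon> / (K - 1) < 1\<close>.  Smoothing with rate \<open>r\<close> after smoothing with rate \<open>s\<close> is
  smoothing with the rate \<open>t\<close> satisfying \<open>1 - t = (1 - r) (1 - s)\<close>, and \<open>r_opt\<close> is the solution
  \<open>r\<close> for \<open>t = r*\<close>.  Hence the noisy risk at rate \<open>r_opt\<close> equals the clean risk at rate \<open>r*\<close> for
  every classifier in the class, so both have the same minimizers.
\<close>

text \<open>Hypothesis \<open>eq\<close> says that \<open>U\<close> and \<open>V\<close> have the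
  same conditional expectation given \<open>X\<close>, phrased through sets only. Both sides of the
  claim are linear in \<open>g\<close> and, as \<open>U\<close> and \<open>V\<close> are bounded,
  pass to dominated limits, so induction on integrable functions over the law of \<open>X\<close>
  lifts \<open>eq\<close> from indicators to \<open>g\<close>.\<close>

lemma (in finite_measure) integral_mult_comp_eqI:
  fixes U V :: "'a \<Rightarrow> real" and g :: "'b \<Rightarrow> real"
  assumes X [measurable]: "X \<in> measurable M N"
    and U [measurable]: "U \<in> borel_measurable M" and Ub: "\<And>w. \<bar>U w\<bar> \<le> B"
    and V [measurable]: "V \<in> borel_measurable M" and Vb: "\<And>w. \<bar>V w\<bar> \<le> B"
    and eq: "\<And>A. A \<in> sets N \<Longrightarrow>
      (\<integral>w. U w * indicator A (X w) \<partial>M) = (\<integral>w. V w * indicator A (X w) \<partial>M)"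
    and g [measurable]: "g \<in> borel_measurable N" and gX: "integrable M (\<lambda>w. g (X w))"
  shows "(\<integral>w. U w * g (X w) \<partial>M) = (\<integral>w. V w * g (X w) \<partial>M)"
proof -
  have intW: "integrable M (\<lambda>w. W w * h (X w))"
    if "W \<in> borel_measurable M" "\<And>w. \<bar>W w\<bar> \<le> B" "integrable (distr M N X) h"
    for W :: "'a \<Rightarrow> real" and h
  proof (rule Bochner_Integration.integrable_bound)
    have hX: "integrable M (\<lambda>w. h (X w))"
      by (rule integrable_distr[OF X that(3)])
    then show "integrable M (\<lambda>w. B * h (X w))" by simp
    show "(\<lambda>w. W w * h (X w)) \<in> borel_measurable M"
      using that(1) hX by measurable
    show "AE w in M. norm (W w * h (X w)) \<le> norm (B * h (X w))"
      using order_trans[OF that(2) abs_ge_self]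
      by (intro AE_I2) (simp add: abs_mult mult_right_mono)
  qed
  have "integrable (distr M N X) g"
    using gX by (simp add: integrable_distr_eq)
  then show ?thesis
  proof (induction rule: integrable_induct)
    case (base A c)
    then have "A \<in> sets N" by simp
    from eq[OF this] show ?case
      by (simp add: mult.left_commute mult.assoc[symmetric] mult.commute[of _ c])
         (simp add: mult.assoc)
  next
    case (add h1 h2)
    then show ?case
      using intW[OF U Ub] intW[OF V Vb] by (simp add: distrib_left)
  next
    case (lim f s)
    have *: "(\<lambda>i. \<integral>w. W w * s i (X w) \<partial>M) \<longlonglongrightarrow> (\<integral>w. W w * f (X w) \<partial>M)"
      if W [measurable]: "W \<in> borel_measurable M" and Wb: "\<And>w. \<bar>W w\<bar> \<le> B" for W
    proof (rule integral_dominated_convergence)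
      have [measurable]: "f \<in> borel_measurable N" "\<And>i. s i \<in> borel_measurable N"
        using lim(1,4) by (auto dest: borel_measurable_integrable)
      show "(\<lambda>w. W w * f (X w)) \<in> borel_measurable M"
        "\<And>i. (\<lambda>w. W w * s i (X w)) \<in> borel_measurable M" by measurable
      have "integrable M (\<lambda>w. f (X w))"
        by (rule integrable_distr[OF X lim(4)])
      \<comment> \<open>The factor 2 comes from \<open>integrable_induct\<close>, whose approximants
        satisfy \<open>norm (s i x) \<le> 2 * norm (f x)\<close>.\<close>
      then show "integrable M (\<lambda>w. B * (2 * norm (f (X w))))" by simp
      have XS: "X w \<in> space (distr M N X)" if "w \<in> space M" for w
        using measurable_space[OF X that] by simp
      show "AE w in M. (\<lambda>i. W w * s i (X w)) \<longlonglongrightarrow> W w * f (X w)"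
        using lim(2) XS by (intro AE_I2 tendsto_mult_left) auto
      have "norm (W w * s i (X w)) \<le> B * (2 * norm (f (X w)))" if "w \<in> space M" for i w
        unfolding norm_mult
        by (rule mult_mono) (use lim(3) XS[OF that] Wb[of w] in auto)
      then show "\<And>i. AE w in M. norm (W w * s i (X w)) \<le> B * (2 * norm (f (X w)))" by simp
    qed
    show ?case
      using LIMSEQ_unique[OF *[OF U Ub]] *[OF V Vb] lim.IH by simp
  qed
qed

text \<open>Condition on the clean label and sum over its values. The transition matrix of symmetric
  noise is \<open>1 - s\<close> times the identity plus \<open>s / K\<close> times the all-ones
  matrix, and the all-ones part sums the clean label out.\<close>

lemma (in prob_space) prob_noisy_label:
  fixes Y Yn :: "'a \<Rightarrow> 'k::finite"
  assumes X [measurable]: "X \<in> measurable M N"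
    and Y [measurable]: "Y \<in> measurable M (count_space UNIV)"
    and Yn [measurable]: "Yn \<in> measurable M (count_space UNIV)"
    and indep: "cond_indep_given_label M N X Yn Y"
    and noise: "symmetric_noise M \<epsilon> Yn Y"
    and K: "CARD('k) \<ge> 2"
    and A [measurable]: "A \<in> sets N"
  defines "s \<equiv> real CARD('k) * \<epsilon> / (real CARD('k) - 1)"
  shows "\<P>(w in M. X w \<in> A \<and> Yn w = j) =
    (1 - s) * \<P>(w in M. X w \<in> A \<and> Y w = j) + s / CARD('k) * \<P>(w in M. X w \<in> A)"
proof -
  let ?T = "\<lambda>i. if j = i then 1 - \<epsilon> else \<epsilon> / (real CARD('k) - 1)"
  let ?q = "\<lambda>i. \<P>(w in M. X w \<in> A \<and> Y w = i)"
  have joint: "\<P>(w in M. (X w \<in> A \<and> Yn w = j) \<and> Y w = i) = ?T i * ?q i" for i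
  proof (cases "\<P>(w in M. Y w = i) > 0")
    case True
    have "\<P>(w in M. X w \<in> A \<and> Yn w = j \<bar> Y w = i) = \<P>(w in M. X w \<in> A \<bar> Y w = i) * ?T i"
      using indep noise A True unfolding cond_indep_given_label_def symmetric_noise_def by simp
    then show ?thesis
      using True by (simp add: cond_prob_def field_simps del: if_split)
  next
    \<comment> \<open>A null label carries no information on its noise, but both joint probabilities
      are bounded by that of \<open>Y w = i\<close>, hence vanish.\<close>
    case False
    then have z: "\<P>(w in M. Y w = i) = 0"
      by (simp add: zero_less_measure_iff)
    have "\<P>(w in M. (X w \<in> A \<and> Yn w = j) \<and> Y w = i) \<le> \<P>(w in M. Y w = i)"
      "?q i \<le> \<P>(w in M. Y w = i)"
      by (auto intro!: finite_measure_mono)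
    then show ?thesis
      unfolding z using measure_nonneg by (simp add: measure_le_0_iff)
  qed
  have total: "\<P>(w in M. P w) = (\<Sum>i\<in>UNIV. \<P>(w in M. P w \<and> Y w = i))"
    if [measurable]: "Measurable.pred M P" for P
    by (rule prob_sum) (auto intro!: AE_I2)
  have "\<P>(w in M. X w \<in> A \<and> Yn w = j) = (\<Sum>i\<in>UNIV. ?T i * ?q i)"
    by (subst total) (simp_all only: joint, measurable)
  also have "\<dots> = (\<Sum>i\<in>UNIV. (if j = i then (1 - s) * ?q i else 0) + s / CARD('k) * ?q i)"
  proof (rule sum.cong)
    have "?T i = (if j = i then 1 - s else 0) + s / CARD('k)" for i
      using K by (simp add: s_def field_simps)
    then show "?T i * ?q i = (if j = i then (1 - s) * ?q i else 0) + s / CARD('k) * ?q i" for i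
      by (simp add: distrib_right)
  qed simp
  also have "\<dots> = (1 - s) * ?q j + s / CARD('k) * \<P>(w in M. X w \<in> A)"
    by (subst (2) total) (simp_all add: sum.distrib sum_distrib_left)
  finally show ?thesis .
qed

lemma gls_nth: "gls r y $ k = (1 - r) * indicator {k} y + r / CARD('k)"
  for y k :: "'k::finite"
  by (auto simp: gls_def one_hot_def axis_def indicator_def)

text \<open>A bound uniform in the label, for integrability and domination. It is not simply 1,
  because a negative rate pushes entries outside the unit interval.\<close>

lemma abs_gls_nth_le: "\<bar>gls r y $ k\<bar> \<le> \<bar>1 - r\<bar> + \<bar>r\<bar>" for y k :: "'k::finite"
proof -
  have "\<bar>r / CARD('k)\<bar> \<le> \<bar>r\<bar> / 1"
    unfolding abs_divide by (rule divide_left_mono) (auto simp: Suc_le_eq)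
  then show ?thesis
    unfolding gls_nth by (cases "y = k") (auto intro: order_trans[OF abs_triangle_ineq])
qed

text \<open>Splits the risk into one integral per class, each a bounded label weight times a
  function of \<open>X\<close>, the shape that \<open>integral_mult_comp_eqI\<close> treats. The
  bounded weight keeps every term integrable, so sum and integral commute.\<close>

lemma gls_risk_data_law:
  fixes Y :: "'w \<Rightarrow> 'k::finite"
  assumes M: "finite_measure M"
    and X [measurable]: "X \<in> measurable M N"
    and Y [measurable]: "Y \<in> measurable M (count_space UNIV)"
    and f [measurable]: "f \<in> borel_measurable N"
    and int: "\<And>k. integrable M (\<lambda>w. ln (f (X w) $ k))"
  shows "gls_risk (data_law M N X Y) r f =
    - (\<Sum>k\<in>UNIV. \<integral>w. gls r (Y w) $ k * ln (f (X w) $ k) \<partial>M)"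
proof -
  have nth [measurable]: "(\<lambda>x. f x $ k) \<in> borel_measurable N" for k
    by (rule borel_measurable_continuous_on[OF _ f]) (intro continuous_intros)
  have i: "integrable M (\<lambda>w. gls r (Y w) $ k * ln (f (X w) $ k))" for k
  proof (rule Bochner_Integration.integrable_bound)
    show "integrable M (\<lambda>w. (\<bar>1 - r\<bar> + \<bar>r\<bar>) * ln (f (X w) $ k))"
      using int by simp
    show "(\<lambda>w. gls r (Y w) $ k * ln (f (X w) $ k)) \<in> borel_measurable M"
      unfolding gls_nth by measurable
    show "AE w in M. norm (gls r (Y w) $ k * ln (f (X w) $ k))
        \<le> norm ((\<bar>1 - r\<bar> + \<bar>r\<bar>) * ln (f (X w) $ k))"
      using abs_gls_nth_le by (intro AE_I2) (auto simp: abs_mult intro!: mult_right_mono)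
  qed
  have "gls_risk (data_law M N X Y) r f = (\<integral>w. ce_loss_vec (f (X w)) (gls r (Y w)) \<partial>M)"
    unfolding gls_risk_def data_law_def
    by (subst integral_distr) (simp_all add: ce_loss_vec_def gls_nth)
  also have "\<dots> = - (\<Sum>k\<in>UNIV. \<integral>w. gls r (Y w) $ k * ln (f (X w) $ k) \<partial>M)"
    unfolding ce_loss_vec_def using i by simp
  finally show ?thesis .
qed

text \<open>Reduces hypothesis \<open>eq\<close> of \<open>integral_mult_comp_eqI\<close> to
  probabilities, in a form into which \<open>prob_noisy_label\<close> can be substituted.\<close>

lemma (in prob_space) integral_gls_indicator:
  fixes Y :: "'a \<Rightarrow> 'k::finite"
  assumes [measurable]: "X \<in> measurable M N" "Y \<in> measurable M (count_space UNIV)" "A \<in> sets N"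
  shows "(\<integral>w. gls r (Y w) $ k * indicator A (X w) \<partial>M) =
    (1 - r) * \<P>(w in M. X w \<in> A \<and> Y w = k) + r / CARD('k) * \<P>(w in M. X w \<in> A)"
proof -
  let ?E = "{w \<in> space M. X w \<in> A \<and> Y w = k}" and ?F = "{w \<in> space M. X w \<in> A}"
  have "(\<integral>w. gls r (Y w) $ k * indicator A (X w) \<partial>M) =
    (\<integral>w. (1 - r) * indicator ?E w + r / CARD('k) * indicator ?F w \<partial>M)"
    by (rule Bochner_Integration.integral_cong) (auto simp: gls_nth indicator_def)
  also have "\<dots> = (1 - r) * prob ?E + r / CARD('k) * prob ?F"
  proof (subst Bochner_Integration.integral_add)
    have E: "integrable M (indicator S :: 'a \<Rightarrow> real)" if "S \<in> events" for S
      using that by (simp add: integrable_indicator_iff emeasure_eq_measure)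
    show "integrable M (\<lambda>w. (1 - r) * indicator ?E w)"
      "integrable M (\<lambda>w. r / CARD('k) * indicator ?F w)"
      by (intro integrable_mult_right E; measurable)+
  qed simp
  finally show ?thesis .
qed

lemma (in prob_space) gls_risk_noisy_eq_clean:
  fixes Y Yn :: "'a \<Rightarrow> 'k::finite"
  assumes X: "X \<in> measurable M N"
    and Y [measurable]: "Y \<in> measurable M (count_space UNIV)"
    and Yn [measurable]: "Yn \<in> measurable M (count_space UNIV)"
    and indep: "cond_indep_given_label M N X Yn Y"
    and noise: "symmetric_noise M \<epsilon> Yn Y"
    and K: "CARD('k) \<ge> 2"
    and f [measurable]: "f \<in> borel_measurable N"
    and int: "\<And>k. integrable M (\<lambda>w. ln (f (X w) $ k))"
    and rate: "1 - t = (1 - r) * (1 - real CARD('k) * \<epsilon> / (real CARD('k) - 1))"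
  shows "gls_risk (data_law M N X Yn) r f = gls_risk (data_law M N X Y) t f"
proof -
  let ?B = "max (\<bar>1 - r\<bar> + \<bar>r\<bar>) (\<bar>1 - t\<bar> + \<bar>t\<bar>)"
  have "(\<integral>w. gls r (Yn w) $ k * ln (f (X w) $ k) \<partial>M) =
    (\<integral>w. gls t (Y w) $ k * ln (f (X w) $ k) \<partial>M)" for k
  proof (rule integral_mult_comp_eqI[OF X, where B = ?B and g = "\<lambda>x. ln (f x $ k)"])
    show "(\<lambda>w. gls r (Yn w) $ k) \<in> borel_measurable M" "(\<lambda>w. gls t (Y w) $ k) \<in> borel_measurable M"
      unfolding gls_nth by measurable
    show "\<bar>gls r (Yn w) $ k\<bar> \<le> ?B" "\<bar>gls t (Y w) $ k\<bar> \<le> ?B" for w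
      using abs_gls_nth_le[of r "Yn w" k] abs_gls_nth_le[of t "Y w" k] by linarith+
    have [measurable]: "(\<lambda>x. f x $ k) \<in> borel_measurable N"
      by (rule borel_measurable_continuous_on[OF _ f]) (intro continuous_intros)
    show "(\<lambda>x. ln (f x $ k)) \<in> borel_measurable N" by measurable
    fix A assume A: "A \<in> sets N"
    define s where "s = real CARD('k) * \<epsilon> / (real CARD('k) - 1)"
    have t: "t = 1 - (1 - r) * (1 - s)"
      using rate by (simp add: s_def)
    \<comment> \<open>Composing the smoothings, the label event gets the coefficient
      \<open>(1 - r) * (1 - s) = 1 - t\<close>, and \<open>X w \<in> A\<close> gets
      \<open>((1 - r) * s + r) / K = t / K\<close>.\<close>
    show "(\<integral>w. gls r (Yn w) $ k * indicator A (X w) \<partial>M) =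
        (\<integral>w. gls t (Y w) $ k * indicator A (X w) \<partial>M)"
      unfolding integral_gls_indicator[OF X Y A] integral_gls_indicator[OF X Yn A]
        prob_noisy_label[OF X Y Yn indep noise K A] t s_def[symmetric]
      by (simp add: field_simps)
  qed (rule int)
  then show ?thesis
    by (simp add: gls_risk_data_law[OF finite_measure_axioms X _ f int])
qed

theorem theorem3p6:
  fixes M :: "'w measure" and N :: "'x measure"
    and X :: "'w \<Rightarrow> 'x" and Y Yn :: "'w \<Rightarrow> 'k::finite"
    and F :: "('x \<Rightarrow> real ^ 'k) set" and fstar :: "'x \<Rightarrow> real ^ 'k"
    and K :: nat and \<epsilon> rs :: real
  assumes K: "K = CARD('k)" "K \<ge> 2"
    and prob: "prob_space M"
    and X: "X \<in> measurable M N"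
    and Y: "Y \<in> measurable M (count_space UNIV)"
    and Yn: "Yn \<in> measurable M (count_space UNIV)"
    and indep: "cond_indep_given_label M N X Yn Y"
    and noise: "symmetric_noise M \<epsilon> Yn Y"
    and eps: "0 \<le> \<epsilon>" "\<epsilon> < (real K - 1) / real K"
    and F_classifier: "\<And>f. f \<in> F \<Longrightarrow> classifier N f"
    and F_integrable: "\<And>f k. f \<in> F \<Longrightarrow> integrable M (\<lambda>w. ln (f (X w) $ k))"
    and rs: "rs \<le> 1"
    and fstar: "is_arg_min (gls_risk (data_law M N X Y) rs) (\<lambda>f. f \<in> F) fstar"
  shows "is_arg_min (gls_risk (data_law M N X Yn) (r_opt K rs \<epsilon>)) (\<lambda>f. f \<in> F) fstar
    \<and> (\<epsilon> < (real K - 1) * rs / real K \<longrightarrow> r_opt K rs \<epsilon> > 0)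
    \<and> (\<epsilon> = (real K - 1) * rs / real K \<longrightarrow> r_opt K rs \<epsilon> = 0)
    \<and> (\<epsilon> > (real K - 1) * rs / real K \<longrightarrow> r_opt K rs \<epsilon> < 0)"
proof -
  interpret prob_space M by (rule prob)
  \<comment> \<open>The noise bound amounts to \<open>s < 1\<close>: the noise rate can be inverted,
    and the denominator of \<open>r_opt\<close> is positive.\<close>
  have pos: "real K - 1 - real K * \<epsilon> > 0"
    using K eps by (simp add: field_simps)
  have "1 - real CARD('k) * \<epsilon> / (real CARD('k) - 1) = (real K - 1 - real K * \<epsilon>) / (real K - 1)"
    using K by (simp add: field_simps)
  moreover have "1 - r_opt K rs \<epsilon> = (1 - rs) * (real K - 1) / (real K - 1 - real K * \<epsilon>)"
    using pos by (simp add: r_opt_def field_simps)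
  ultimately have rate: "1 - rs = (1 - r_opt K rs \<epsilon>) * (1 - real CARD('k) * \<epsilon> / (real CARD('k) - 1))"
    using pos K by simp
  have "gls_risk (data_law M N X Yn) (r_opt K rs \<epsilon>) f = gls_risk (data_law M N X Y) rs f"
    if "f \<in> F" for f
    using gls_risk_noisy_eq_clean[OF X Y Yn indep noise _ _ F_integrable[OF that] rate]
      F_classifier[OF that] K by (simp add: classifier_def)
  \<comment> \<open>\<open>is_arg_min\<close> includes \<open>fstar \<in> F\<close>, so the equality
    of risks applies to \<open>fstar\<close> as well as to each competitor.\<close>
  then have "is_arg_min (gls_risk (data_law M N X Yn) (r_opt K rs \<epsilon>)) (\<lambda>f. f \<in> F) fstar"
    using fstar by (auto simp: is_arg_min_def)
  \<comment> \<open>Cleared of \<open>K\<close>, the three thresholds give the sign of the numerator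
    of \<open>r_opt\<close>, which by \<open>pos\<close> is the sign of
    \<open>r_opt\<close>.\<close>
  moreover have "\<epsilon> < (real K - 1) * rs / real K \<longleftrightarrow> real K * \<epsilon> < (real K - 1) * rs"
    "\<epsilon> = (real K - 1) * rs / real K \<longleftrightarrow> real K * \<epsilon> = (real K - 1) * rs"
    "\<epsilon> > (real K - 1) * rs / real K \<longleftrightarrow> real K * \<epsilon> > (real K - 1) * rs"
    using K by (auto simp: field_simps)
  ultimately show ?thesis
    using pos by (simp add: r_opt_def divide_less_0_iff)
qed

end
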